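(* For $k^2<\delta n$ we have $R_\delta(\mathrm{Ham}^n_k)=\Omega(k\log(k/\delta))$. The bound applies even to protocols that are only required to be correct (with probability at least $1-\delta$) on input pairs $(x,y)$ with $\|x-y\|_1\in\{k-2,k,k+2\}$ and may output an arbitrary answer on other inputs.
   Context: In the $k$-Hamming distance problem $\mathrm{Ham}^n_k$, Alice receives $x\in\{0,1\}^n$, Bob receives $y\in\{0,1\}^n$, and they must output 1 if $\|x-y\|_1\le k$ and 0 otherwise. A randomized two-party protocol lets the players exchange messages (bit strings), basing their actions on their own input, previous messages and a shared public random source; its error probability is the maximum over inputs of the probability that its output differs from the correct value; its communication cost is the maximum over inputs and random strings of the total number of bits exchanged. $R_\delta(f)$ is the minimum communication cost of a randomized protocol (with any number of rounds) computing $f$ with error probability at most $\delta$. Logarithms are base 2.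
   Formalization: The error probability δ is restricted to 0 < δ ≤ 1/3; without a bound on δ the claim fails (for δ = 1/2 a fair coin costs 0 bits), and for δ up to any fixed constant below 1/2 it follows by standard amplification. *)

theory Defs
  imports "HOL-Probability.Probability"
begin

text \<open>Deterministic two-party protocol trees. Inputs are bit strings (bool lists).
  An Alice node sends one bit computed from Alice's input (the path so far is
  implicit in the tree position); a Bob node likewise from Bob's input.
  Leaves carry the output.\<close>

datatype ptree =
    Leaf bool
  | ANode "bool list \<Rightarrow> bool" ptree ptree
  | BNode "bool list \<Rightarrow> bool" ptree ptree

fun run :: "ptree \<Rightarrow> bool list \<Rightarrow> bool list \<Rightarrow> bool" where
  "run (Leaf b) x y = b"
| "run (ANode f l r) x y = (if f x then run r x y else run l x y)"
| "run (BNode g l r) x y = (if g y then run r x y else run l x y)"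

fun depth :: "ptree \<Rightarrow> nat" where
  "depth (Leaf b) = 0"
| "depth (ANode f l r) = Suc (max (depth l) (depth r))"
| "depth (BNode g l r) = Suc (max (depth l) (depth r))"

text \<open>A public-coin randomized protocol is a probability distribution over
  deterministic protocol trees.\<close>
type_synonym rprotocol = "ptree pmf"

definition hamming :: "bool list \<Rightarrow> bool list \<Rightarrow> nat" where
  "hamming x y = card {i. i < length x \<and> i < length y \<and> x ! i \<noteq> y ! i}"

definition Ham :: "nat \<Rightarrow> bool list \<Rightarrow> bool list \<Rightarrow> bool" where
  "Ham k x y = (hamming x y \<le> k)"

definition err_prob :: "rprotocol \<Rightarrow> (bool list \<Rightarrow> bool list \<Rightarrow> bool) \<Rightarrow> bool list \<Rightarrow> bool list \<Rightarrow> real" where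
  "err_prob P f x y = measure_pmf.prob P {t. run t x y \<noteq> f x y}"

definition cost_le :: "rprotocol \<Rightarrow> nat \<Rightarrow> bool" where
  "cost_le P c = (\<forall>t\<in>set_pmf P. depth t \<le> c)"

end

theory Submission
  imports Defs
begin

text \<open>
  Let \<open>q\<^sub>s\<close> be the probability that a stationary \<open>s\<close>-step walk on the cube starts in \<open>A\<close> and ends in
  \<open>B\<close>. Let \<open>X\<close> be the \<open>t\<close>-step walk conditioned on this event, and insert a detour at step \<open>i\<close>:
  walk to \<open>X\<^sub>i\<^sub>+\<^sub>1\<close>, resample \<open>X\<^sub>i\<close> given \<open>X\<^sub>i\<^sub>+\<^sub>1\<close>, then resample the rest of the walk given \<open>X\<^sub>i\<close>. This is
  a \<open>(t + 2)\<close>-step walk whose density with respect to the stationary walk is \<open>\<phi>\<^sub>i / q\<^sub>t\<close>, where \<open>\<phi>\<^sub>i\<close>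
  depends only on the edge traversed backwards. Let \<open>E\<close> be the expectation over stationary
  \<open>(t + 2)\<close>-step walks restricted to those from \<open>A\<close> to \<open>B\<close>. Then \<open>E \<phi>\<^sub>i = q\<^sub>t\<close>, and summing out the
  vertices shows that \<open>E (\<phi>\<^sub>i \<phi>\<^sub>j) = q\<^sub>t\<^sub>-\<^sub>2\<close> for \<open>i \<noteq> j\<close>. The relative entropy of \<open>X\<close> telescopes over
  the steps, so by Markov's inequality truncating all \<open>\<phi>\<^sub>i\<close> at \<open>T\<close> loses only a small fraction of
  \<open>(\<Sum>i. E \<phi>\<^sub>i)\<close> unless \<open>ln (1 / q\<^sub>t)\<close> is of order \<open>t ln T\<close>. Expanding \<open>0 \<le> E (c t - (\<Sum>i. \<phi>\<^sub>i))\<^sup>2\<close> for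
  the truncated \<open>\<phi>\<^sub>i\<close> gives, for every \<open>c \<ge> 0\<close>,
  \<open>2 c (1 - \<eta>) q\<^sub>t \<le> c\<^sup>2 q\<^sub>t\<^sub>+\<^sub>2 + q\<^sub>t\<^sub>-\<^sub>2 + (T / t) q\<^sub>t\<close>.

  The inequality is linear in the masses, so it adds up over the accepting leaf rectangles of a
  protocol; the leaves with tiny \<open>q\<^sub>t\<close> contribute little because there are at most \<open>2\<^sup>c\<^sup>o\<^sup>s\<^sup>t\<close> of them.
  With \<open>T\<close> proportional to \<open>t / \<delta>\<close>, accepting with probability about \<open>1 - \<delta>\<close> after \<open>t\<close> steps and
  about \<open>\<delta>\<close> after \<open>t + 2\<close> steps is then contradictory for cheap protocols. For \<open>t\<^sup>2\<close> much smaller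
  than the dimension, \<open>t\<close> steps almost always lead to distance exactly \<open>t\<close>; this regime is reached
  from \<open>k\<^sup>2 < \<delta> n\<close> by fixing most of the \<open>k\<close> differences in advance, which leaves \<open>t \<approx> k / 10\<close>.
\<close>

section \<open>Heat flow of a symmetric substochastic kernel\<close>

locale symmetric_substochastic =
  fixes V :: "'v set" and K :: "'v \<Rightarrow> 'v \<Rightarrow> real"
  assumes finite_V: "finite V"
    and K_nonneg: "\<And>x y. 0 \<le> K x y"
    and K_sym: "\<And>x y. x \<in> V \<Longrightarrow> y \<in> V \<Longrightarrow> K x y = K y x"
    and K_sum: "\<And>x. x \<in> V \<Longrightarrow> (\<Sum>y\<in>V. K x y) \<le> 1"
begin

primrec heat :: "nat \<Rightarrow> ('v \<Rightarrow> real) \<Rightarrow> 'v \<Rightarrow> real" where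
  "heat 0 f x = f x"
| "heat (Suc s) f x = (\<Sum>y\<in>V. K x y * heat s f y)"

text \<open>Not divided by \<open>card V\<close>: for indicators \<open>u\<close>, \<open>v\<close>
  of \<open>A\<close>, \<open>B\<close>, \<open>measured u (heat s v)\<close> is
  \<open>card V\<close> times the probability \<open>q\<^sub>s\<close> above.\<close>

definition measured :: "('v \<Rightarrow> real) \<Rightarrow> ('v \<Rightarrow> real) \<Rightarrow> real" where
  "measured f g = (\<Sum>x\<in>V. f x * g x)"

lemma heat_add: "x \<in> V \<Longrightarrow> heat s (\<lambda>y. f y + g y) x = heat s f x + heat s g x"
  by (induction s arbitrary: x) (auto simp: algebra_simps sum.distrib)

lemma heat_mono:
  "(\<And>y. y \<in> V \<Longrightarrow> f y \<le> g y) \<Longrightarrow> x \<in> V \<Longrightarrow> heat s f x \<le> heat s g x"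
  by (induction s arbitrary: x) (auto intro!: sum_mono mult_left_mono K_nonneg)

lemma heat_nonneg: "(\<And>y. y \<in> V \<Longrightarrow> 0 \<le> f y) \<Longrightarrow> x \<in> V \<Longrightarrow> 0 \<le> heat s f x"
  by (induction s arbitrary: x) (auto intro!: sum_nonneg mult_nonneg_nonneg K_nonneg)

lemma heat_le_1:
  assumes "\<And>y. y \<in> V \<Longrightarrow> f y \<le> 1" "x \<in> V"
  shows "heat s f x \<le> 1"
  using assms(2)
proof (induction s arbitrary: x)
  case (Suc s)
  have "heat (Suc s) f x \<le> (\<Sum>y\<in>V. K x y * 1)"
    unfolding heat.simps by (intro sum_mono mult_left_mono K_nonneg Suc.IH)
  also have "\<dots> \<le> 1" using K_sum[OF Suc.prems] by simp
  finally show ?case .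
qed (use assms in auto)

lemma heat_cmult: "heat s (\<lambda>y. a * f y) x = a * heat s f x"
  by (induction s arbitrary: x) (auto simp: sum_distrib_left intro!: sum.cong)

lemma heat_Suc_eq: "heat (Suc s) f = (\<lambda>x. \<Sum>y\<in>V. K x y * heat s f y)"
  by (rule ext) simp

lemma heat_Suc_right: "heat (Suc s) f x = heat s (\<lambda>y. \<Sum>z\<in>V. K y z * f z) x"
  by (induction s arbitrary: x) auto

lemma sum_kernel_swap:
  "(\<Sum>x\<in>V. \<Sum>y\<in>V. K x y * F x y) = (\<Sum>x\<in>V. \<Sum>y\<in>V. K x y * F y x)"
proof -
  have "(\<Sum>x\<in>V. \<Sum>y\<in>V. K x y * F x y) = (\<Sum>y\<in>V. \<Sum>x\<in>V. K x y * F x y)"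
    by (rule sum.swap)
  also have "\<dots> = (\<Sum>y\<in>V. \<Sum>x\<in>V. K y x * F x y)"
    by (intro sum.cong refl) (simp add: K_sym)
  finally show ?thesis .
qed

lemma measured_step:
  "measured f (\<lambda>x. \<Sum>y\<in>V. K x y * g y) = (\<Sum>x\<in>V. \<Sum>y\<in>V. K x y * (f x * g y))"
  unfolding measured_def by (simp add: sum_distrib_left mult_ac)

lemma measured_step_adjoint:
  "measured (\<lambda>x. \<Sum>y\<in>V. K x y * f y) g = measured f (\<lambda>x. \<Sum>y\<in>V. K x y * g y)"
proof -
  have "measured (\<lambda>x. \<Sum>y\<in>V. K x y * f y) g = (\<Sum>x\<in>V. \<Sum>y\<in>V. K x y * (f y * g x))"
    unfolding measured_def by (simp add: sum_distrib_right mult.assoc)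
  thus ?thesis by (simp add: measured_step sum_kernel_swap[of "\<lambda>x y. f x * g y"])
qed

text \<open>A symmetric kernel is self-adjoint, so steps can be moved from one end of the walk to
  the other.\<close>

lemma measured_heat_heat: "measured (heat a f) (heat b g) = measured f (heat (a + b) g)"
proof (induction a arbitrary: b)
  case 0
  show ?case by (simp add: measured_def)
next
  case (Suc a)
  have "measured (heat (Suc a) f) (heat b g) = measured (heat a f) (heat (Suc b) g)"
    unfolding heat_Suc_eq by (rule measured_step_adjoint)
  thus ?case using Suc[of "Suc b"] by (simp del: heat.simps)
qed

text \<open>For the walk \<open>y\<^sub>0, y\<^sub>1, \<dots>\<close> with \<open>y\<^sub>0\<close> weighted by \<open>u\<close> and the additive functional
  \<open>F = (\<Sum>m. \<psi> m y\<^sub>m y\<^sub>m\<^sub>+\<^sub>1)\<close>, the functions \<open>moment1\<close> and \<open>moment2\<close> are the first and second moments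
  of \<open>F\<close> restricted to walks that end in a given vertex.\<close>

primrec moment1 where
  "moment1 \<psi> u 0 z = (0::real)"
| "moment1 \<psi> u (Suc m) z = (\<Sum>w\<in>V. K z w * (moment1 \<psi> u m w + \<psi> m w z * heat m u w))"

primrec moment2 where
  "moment2 \<psi> u 0 z = (0::real)"
| "moment2 \<psi> u (Suc m) z =
    (\<Sum>w\<in>V. K z w * (moment2 \<psi> u m w + (2 * \<psi> m w z * moment1 \<psi> u m w + (\<psi> m w z)\<^sup>2 * heat m u w)))"

text \<open>This is the second moment of \<open>c - F\<close> on walks ending in \<open>z\<close>.
  Peeling off the last step turns \<open>c\<close> into \<open>c - \<psi> m w z\<close>, hence the
  induction over all \<open>c\<close>.\<close>

lemma moment_quadratic_nonneg:
  assumes "\<And>x. x \<in> V \<Longrightarrow> 0 \<le> u x" and "z \<in> V"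
  shows "0 \<le> c\<^sup>2 * heat m u z - 2 * c * moment1 \<psi> u m z + moment2 \<psi> u m z"
  using assms(2)
proof (induction m arbitrary: c z)
  case 0
  thus ?case using assms(1) by simp
next
  case (Suc m)
  have "c\<^sup>2 * heat (Suc m) u z - 2 * c * moment1 \<psi> u (Suc m) z + moment2 \<psi> u (Suc m) z
    = (\<Sum>w\<in>V. K z w * ((c - \<psi> m w z)\<^sup>2 * heat m u w - 2 * (c - \<psi> m w z) * moment1 \<psi> u m w
                        + moment2 \<psi> u m w))"
    by (simp add: sum_distrib_left sum_subtractf[symmetric] sum.distrib[symmetric])
       (intro sum.cong refl, simp add: algebra_simps power2_eq_square)
  thus ?case using Suc by (simp only:) (intro sum_nonneg mult_nonneg_nonneg K_nonneg)
qed

text \<open>Duhamel's formula: the source \<open>b m\<close> enters at step \<open>m\<close>, and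
  the remaining \<open>N - 1 - m\<close> steps are moved onto \<open>v\<close> by
  self-adjointness.\<close>

lemma measured_recursion:
  assumes "\<And>z. z \<in> V \<Longrightarrow> a 0 z = 0"
    and "\<And>m z. z \<in> V \<Longrightarrow> a (Suc m) z = (\<Sum>w\<in>V. K z w * (a m w + b m w z))"
  shows "measured v (a N) =
    (\<Sum>m<N. \<Sum>w\<in>V. \<Sum>z\<in>V. K w z * (heat (N - 1 - m) v z * b m w z))"
proof -
  have "measured (heat s v) (a N) =
    (\<Sum>m<N. \<Sum>w\<in>V. \<Sum>z\<in>V. K w z * (heat (s + (N - 1 - m)) v z * b m w z))" for s
  proof (induction N arbitrary: s)
    case 0
    show ?case by (simp add: measured_def assms)
  next
    case (Suc N)
    have "measured (heat s v) (a (Suc N))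
       = (\<Sum>z\<in>V. \<Sum>w\<in>V. K z w * (heat s v z * a N w + heat s v z * b N w z))"
      unfolding measured_def by (simp add: assms(2) sum_distrib_left algebra_simps)
    also have "\<dots> = measured (heat s v) (\<lambda>z. \<Sum>w\<in>V. K z w * a N w)
       + (\<Sum>z\<in>V. \<Sum>w\<in>V. K z w * (heat s v z * b N w z))"
      by (simp add: measured_step algebra_simps sum.distrib)
    also have "measured (heat s v) (\<lambda>z. \<Sum>w\<in>V. K z w * a N w) = measured (heat (Suc s) v) (a N)"
      unfolding heat_Suc_eq by (rule measured_step_adjoint[symmetric])
    also have "\<dots> = (\<Sum>m<N. \<Sum>w\<in>V. \<Sum>z\<in>V. K w z * (heat (s + (Suc N - 1 - m)) v z * b m w z))"
      unfolding Suc by (intro sum.cong refl) (simp add: Suc_diff_le less_imp_le_nat Suc_diff_Suc)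
    also have "(\<Sum>z\<in>V. \<Sum>w\<in>V. K z w * (heat s v z * b N w z))
        = (\<Sum>w\<in>V. \<Sum>z\<in>V. K w z * (heat s v z * b N w z))"
      by (rule sum_kernel_swap)
    finally show ?case by simp
  qed
  from this[of 0] show ?thesis by (simp add: measured_def)
qed

end


section \<open>Near log-convexity of measured heat\<close>

locale measured_heat = symmetric_substochastic +
  fixes u v :: "'a \<Rightarrow> real" and t :: nat
  assumes u_nonneg: "\<And>x. x \<in> V \<Longrightarrow> 0 \<le> u x" and u_le_1: "\<And>x. x \<in> V \<Longrightarrow> u x \<le> 1"
    and v_nonneg: "\<And>x. x \<in> V \<Longrightarrow> 0 \<le> v x" and v_le_1: "\<And>x. x \<in> V \<Longrightarrow> v x \<le> 1"
    and measured_pos: "0 < measured u (heat t v)"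
begin

abbreviation q :: "nat \<Rightarrow> real" where "q s \<equiv> measured u (heat s v)"
text \<open>Up to the factor \<open>q t\<close>, \<open>g i x * h i x\<close> is the law of
  \<open>X\<^sub>i\<close>, and \<open>K w z * (h (Suc i) w * g i z)\<close> is the law of the edge
  \<open>X\<^sub>i = z\<close>, \<open>X\<^sub>i\<^sub>+\<^sub>1 = w\<close>.\<close>

abbreviation g :: "nat \<Rightarrow> 'a \<Rightarrow> real" where "g i \<equiv> heat i u"
abbreviation h :: "nat \<Rightarrow> 'a \<Rightarrow> real" where "h i \<equiv> heat (t - i) v"

lemma g_nonneg: "x \<in> V \<Longrightarrow> 0 \<le> g i x"
  by (rule heat_nonneg[OF u_nonneg])

lemma h_nonneg: "x \<in> V \<Longrightarrow> 0 \<le> h i x"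
  by (rule heat_nonneg[OF v_nonneg])

lemma h_step: "i < t \<Longrightarrow> h i x = (\<Sum>y\<in>V. K x y * h (Suc i) y)"
  using heat.simps(2)[of "t - Suc i" v x] by (simp add: Suc_diff_Suc)

lemma q_nonneg: "0 \<le> q s"
  unfolding measured_def by (intro sum_nonneg mult_nonneg_nonneg u_nonneg heat_nonneg[OF v_nonneg])

lemma measured_commute: "measured a b = measured b a"
  by (simp add: measured_def mult.commute)

lemma g_pos:
  assumes "w \<in> V" "z \<in> V" "K w z > 0" "g i z > 0"
  shows "g (Suc i) w > 0"
proof -
  have "0 < K w z * g i z" using assms by simp
  also have "\<dots> \<le> g (Suc i) w"
    using assms by (auto intro!: member_le_sum finite_V mult_nonneg_nonneg K_nonneg g_nonneg)
  finally show ?thesis .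
qed

lemma h_pos:
  assumes "i < t" "w \<in> V" "z \<in> V" "K w z > 0" "h (Suc i) w > 0"
  shows "h i z > 0"
proof -
  have "0 < K z w * h (Suc i) w" using assms K_sym by simp
  also have "\<dots> \<le> h i z"
    unfolding h_step[OF assms(1)]
    using assms by (auto intro!: member_le_sum finite_V mult_nonneg_nonneg K_nonneg h_nonneg)
  finally show ?thesis .
qed

lemma edge_sum_right:
  "(\<Sum>w\<in>V. \<Sum>z\<in>V. K w z * (h (Suc i) w * g i z * b w)) = (\<Sum>w\<in>V. g (Suc i) w * h (Suc i) w * b w)"
  by (simp add: sum_distrib_left sum_distrib_right mult_ac)

lemma edge_sum_left:
  assumes "i < t"
  shows "(\<Sum>w\<in>V. \<Sum>z\<in>V. K w z * (h (Suc i) w * g i z * b z)) = (\<Sum>z\<in>V. g i z * h i z * b z)"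
proof -
  have "(\<Sum>w\<in>V. \<Sum>z\<in>V. K w z * (h (Suc i) w * g i z * b z))
      = (\<Sum>z\<in>V. \<Sum>w\<in>V. K z w * (h (Suc i) w * g i z * b z))"
    by (rule sum_kernel_swap)
  thus ?thesis by (simp add: h_step[OF assms] sum_distrib_left sum_distrib_right mult_ac)
qed

lemma measured_g_h: "i \<le> t \<Longrightarrow> (\<Sum>x\<in>V. g i x * h i x) = q t"
  using measured_heat_heat[of i u "t - i" v] by (simp add: measured_def)

lemma edge_sum: "i < t \<Longrightarrow> (\<Sum>w\<in>V. \<Sum>z\<in>V. K w z * (h (Suc i) w * g i z)) = q t"
  using edge_sum_right[of i "\<lambda>_. 1"] measured_g_h[of "Suc i"] by simp

section \<open>Relative entropy and the loss from truncation\<close>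

lemma card_V_pos: "0 < real (card V)"
proof -
  have "V \<noteq> {}" using measured_pos by (auto simp: measured_def)
  thus ?thesis using finite_V by (simp add: card_gt_0_iff)
qed

text \<open>Gibbs' inequality against the constant \<open>q t / card V\<close>: convexity bounds
  \<open>b * ln b\<close> below by its tangent there, and \<open>a \<le> 1\<close> controls the
  total weight.\<close>

lemma relative_entropy_bound:
  assumes a: "\<And>x. x \<in> V \<Longrightarrow> 0 \<le> a x" "\<And>x. x \<in> V \<Longrightarrow> a x \<le> 1"
    and b: "\<And>x. x \<in> V \<Longrightarrow> 0 \<le> b x" and ab: "(\<Sum>x\<in>V. a x * b x) = q t"
  shows "- (\<Sum>x\<in>V. a x * b x * ln (b x)) \<le> q t * ln (card V / q t)"
proof -
  define c where "c = q t / card V"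
  have c: "c > 0" using measured_pos card_V_pos by (simp add: c_def)
  have pt: "b * ln c + b - c \<le> b * ln b" if "b \<ge> 0" for b :: real
  proof (cases "b = 0")
    case False
    hence b: "b > 0" using that by simp
    have "ln (c / b) \<le> c / b - 1" using b c by (intro ln_le_minus_one) simp
    hence "b * (ln c - ln b) \<le> b * (c / b - 1)" using b c by (intro mult_left_mono) (auto simp: ln_div)
    thus ?thesis using b by (simp add: algebra_simps)
  qed (use c in simp)
  have "(\<Sum>x\<in>V. a x * (b x * ln c + b x - c)) \<le> (\<Sum>x\<in>V. a x * (b x * ln (b x)))"
    using a b by (intro sum_mono mult_left_mono pt) auto
  moreover have "(\<Sum>x\<in>V. a x * (b x * ln c + b x - c))
      = (\<Sum>x\<in>V. a x * b x) * ln c + (\<Sum>x\<in>V. a x * b x) - c * (\<Sum>x\<in>V. a x)"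
    by (simp add: algebra_simps sum.distrib sum_subtractf sum_distrib_left)
  moreover have "c * (\<Sum>x\<in>V. a x) \<le> q t"
  proof -
    have "(\<Sum>x\<in>V. a x) \<le> card V" using sum_mono[of V a "\<lambda>_. 1"] a by simp
    hence "c * (\<Sum>x\<in>V. a x) \<le> c * card V" using c by (intro mult_left_mono) auto
    thus ?thesis using card_V_pos by (simp add: c_def)
  qed
  moreover have "ln (card V / q t) = - ln c"
    using measured_pos card_V_pos by (simp add: c_def ln_div)
  ultimately show ?thesis by (simp add: ab mult.assoc)
qed

text \<open>For the walk \<open>X\<close> conditioned on \<open>u\<close> and \<open>v\<close> at its two ends, \<open>K w z\<^sup>2 * ratio i w z\<close> is
  \<open>P(X\<^sub>i = z | X\<^sub>i\<^sub>+\<^sub>1 = w) * P(X\<^sub>i\<^sub>+\<^sub>1 = w | X\<^sub>i = z)\<close>.\<close>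

definition ratio :: "nat \<Rightarrow> 'a \<Rightarrow> 'a \<Rightarrow> real" where
  "ratio i w z = h (Suc i) w * g i z / (g (Suc i) w * h i z)"

lemma ratio_nonneg: "w \<in> V \<Longrightarrow> z \<in> V \<Longrightarrow> 0 \<le> ratio i w z"
  unfolding ratio_def by (intro divide_nonneg_nonneg mult_nonneg_nonneg g_nonneg h_nonneg)

text \<open>Only an inequality, since division by zero makes the ratio 0 where its denominator
  vanishes.\<close>

lemma ratio_mult_le:
  assumes "w \<in> V" "z \<in> V"
  shows "ratio i w z * (g (Suc i) w * h i z) \<le> h (Suc i) w * g i z"
  using g_nonneg[OF assms(1)] h_nonneg[OF assms(2)] g_nonneg[OF assms(2)] h_nonneg[OF assms(1)]
  by (auto simp: ratio_def)

text \<open>The logarithm of the ratio is a difference of \<open>ln (h / g)\<close> at the two ends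
  of the edge, so it telescopes in \<open>i\<close>. Its negative part is paid for by
  \<open>ln x \<le> x - 1\<close>, which gives the last two terms.\<close>

lemma ratio_pointwise:
  assumes i: "i < t" and w: "w \<in> V" and z: "z \<in> V" and T: "1 < T"
  shows "K w z * (h (Suc i) w * g i z) * of_bool (T < ratio i w z) * ln T
    \<le> K w z * (h (Suc i) w * g i z * (ln (h (Suc i) w) - ln (g (Suc i) w)))
      - K w z * (h (Suc i) w * g i z * (ln (h i z) - ln (g i z)))
      + (K w z * (g i z * h i z) + K w z * (g (Suc i) w * h (Suc i) w))"
proof (cases "K w z = 0 \<or> h (Suc i) w = 0 \<or> g i z = 0")
  case True
  moreover have "0 \<le> K w z * (g i z * h i z) + K w z * (g (Suc i) w * h (Suc i) w)"
    by (intro add_nonneg_nonneg mult_nonneg_nonneg K_nonneg g_nonneg h_nonneg w z)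
  ultimately show ?thesis by auto
next
  case False
  define a b a' b' where "a = h (Suc i) w" and "b = g i z" and "a' = h i z" and "b' = g (Suc i) w"
  have K: "K w z > 0" using False K_nonneg[of w z] by simp
  have ab: "a > 0" "b > 0" using False h_nonneg[OF w, of "Suc i"] g_nonneg[OF z, of i]
    by (auto simp: a_def b_def)
  have ab': "a' > 0" "b' > 0"
    using h_pos[OF i w z K] g_pos[OF w z K] ab unfolding a_def b_def a'_def b'_def by auto
  have r: "ratio i w z = a * b / (b' * a')" by (simp add: ratio_def a_def b_def a'_def b'_def)
  have "ln (ratio i w z) = ln a - ln b' - (ln a' - ln b)"
    unfolding r using ab ab' by (simp add: ln_div ln_mult)
  have l1: "ln (a' / a) \<le> a' / a - 1" "ln (b' / b) \<le> b' / b - 1"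
    using ab ab' by (intro ln_le_minus_one; simp)+
  have "of_bool (T < ratio i w z) * ln T \<le> ln a - ln b' - (ln a' - ln b) + (a' / a + b' / b)"
  proof (cases "T < ratio i w z")
    case True
    hence "ln T < ln (ratio i w z)" using T by simp
    thus ?thesis using True ab ab' \<open>ln (ratio i w z) = _\<close> by (simp add: add_increasing2)
  next
    case False
    thus ?thesis using l1 ab ab' by (simp add: ln_div)
  qed
  hence "(K w z * (a * b)) * (of_bool (T < ratio i w z) * ln T)
      \<le> (K w z * (a * b)) * (ln a - ln b' - (ln a' - ln b) + (a' / a + b' / b))"
    using K ab by (intro mult_left_mono) auto
  also have "\<dots> = K w z * (a * b * (ln a - ln b')) - K w z * (a * b * (ln a' - ln b))
      + (K w z * (b * a') + K w z * (b' * a))"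
    using ab by (simp add: field_simps)
  finally show ?thesis unfolding a_def b_def a'_def b'_def by (simp add: mult_ac)
qed

text \<open>Markov's inequality for the logarithm of the ratio: after telescoping only
  \<open>D t - D 0\<close> remains, and each end costs one relative entropy because \<open>u\<close>
  and \<open>v\<close> are at most 1.\<close>

lemma truncated_mass:
  assumes T: "1 < T"
  shows "(\<Sum>i<t. \<Sum>w\<in>V. \<Sum>z\<in>V. K w z * (h (Suc i) w * g i z) * of_bool (T < ratio i w z)) * ln T
    \<le> q t * (2 * ln (card V / q t) + 2 * t)"
proof -
  define D where "D i = (\<Sum>x\<in>V. g i x * h i x * (ln (h i x) - ln (g i x)))" for i
  have K1: "(\<Sum>w\<in>V. \<Sum>z\<in>V. K w z * b w) \<le> (\<Sum>w\<in>V. b w)" if "\<And>w. w \<in> V \<Longrightarrow> 0 \<le> b w" for b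
    using that by (auto simp: sum_distrib_right[symmetric] intro!: sum_mono mult_left_le_one_le sum_nonneg K_nonneg K_sum)
  have ln_nonpos: "ln x \<le> 0" if "0 \<le> x" "x \<le> 1" for x :: real
    using that by (cases "x = 0") auto
  have step: "(\<Sum>w\<in>V. \<Sum>z\<in>V. K w z * (h (Suc i) w * g i z) * of_bool (T < ratio i w z) * ln T)
      \<le> D (Suc i) - D i + 2 * q t" if i: "i < t" for i
  proof -
    have "(\<Sum>w\<in>V. \<Sum>z\<in>V. K w z * (h (Suc i) w * g i z) * of_bool (T < ratio i w z) * ln T)
      \<le> (\<Sum>w\<in>V. \<Sum>z\<in>V. K w z * (h (Suc i) w * g i z * (ln (h (Suc i) w) - ln (g (Suc i) w)))
      - K w z * (h (Suc i) w * g i z * (ln (h i z) - ln (g i z)))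
      + (K w z * (g i z * h i z) + K w z * (g (Suc i) w * h (Suc i) w)))"
      by (intro sum_mono ratio_pointwise i T)
    also have "\<dots> = D (Suc i) - D i + ((\<Sum>w\<in>V. \<Sum>z\<in>V. K w z * (g i z * h i z))
        + (\<Sum>w\<in>V. \<Sum>z\<in>V. K w z * (g (Suc i) w * h (Suc i) w)))"
      unfolding D_def edge_sum_left[OF i, symmetric] edge_sum_right[symmetric]
      by (simp only: sum.distrib sum_subtractf)
    also have "(\<Sum>w\<in>V. \<Sum>z\<in>V. K w z * (g i z * h i z)) = (\<Sum>w\<in>V. \<Sum>z\<in>V. K w z * (g i w * h i w))"
      by (rule sum_kernel_swap)
    also have "\<dots> \<le> q t"
      using K1[of "\<lambda>w. g i w * h i w"] measured_g_h[of i] i g_nonneg h_nonneg by simp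
    also have "(\<Sum>w\<in>V. \<Sum>z\<in>V. K w z * (g (Suc i) w * h (Suc i) w)) \<le> q t"
      using K1[of "\<lambda>w. g (Suc i) w * h (Suc i) w"] measured_g_h[of "Suc i"] i g_nonneg h_nonneg
      by (simp del: heat.simps)
    finally show ?thesis by simp
  qed
  have "(\<Sum>i<t. \<Sum>w\<in>V. \<Sum>z\<in>V. K w z * (h (Suc i) w * g i z) * of_bool (T < ratio i w z)) * ln T
     = (\<Sum>i<t. \<Sum>w\<in>V. \<Sum>z\<in>V. K w z * (h (Suc i) w * g i z) * of_bool (T < ratio i w z) * ln T)"
    by (simp only: sum_distrib_right)
  also have "\<dots> \<le> (\<Sum>i<t. D (Suc i) - D i + 2 * q t)"
    by (intro sum_mono step) simp
  also have "\<dots> = D t + - D 0 + 2 * t * q t"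
    by (simp only: sum.distrib sum_lessThan_telescope) simp
  also have "D t \<le> q t * ln (card V / q t)"
  proof -
    have "(\<Sum>x\<in>V. g t x * h t x * ln (h t x)) \<le> 0"
      using v_nonneg v_le_1 g_nonneg
      by (intro sum_nonpos mult_nonneg_nonpos) (auto intro!: mult_nonneg_nonneg ln_nonpos)
    moreover have "- (\<Sum>x\<in>V. v x * g t x * ln (g t x)) \<le> q t * ln (card V / q t)"
      using measured_g_h[of t] by (intro relative_entropy_bound v_nonneg v_le_1 g_nonneg) (auto simp: mult.commute)
    ultimately show ?thesis unfolding D_def by (simp add: algebra_simps sum_subtractf)
  qed
  also have "- D 0 \<le> q t * ln (card V / q t)"
  proof -
    have "(\<Sum>x\<in>V. g 0 x * h 0 x * ln (g 0 x)) \<le> 0"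
      using u_nonneg u_le_1 h_nonneg[of _ 0]
      by (intro sum_nonpos mult_nonneg_nonpos) (auto intro!: mult_nonneg_nonneg ln_nonpos)
    moreover have "- (\<Sum>x\<in>V. u x * h 0 x * ln (h 0 x)) \<le> q t * ln (card V / q t)"
      using measured_g_h[of 0] by (intro relative_entropy_bound u_nonneg u_le_1 h_nonneg) auto
    ultimately show ?thesis unfolding D_def by (simp add: algebra_simps sum_subtractf)
  qed
  finally show ?thesis by (simp add: algebra_simps)
qed


text \<open>Detour \<open>i\<close> runs backwards at step \<open>Suc i\<close> of the longer walk,
  so the index is shifted by one and the first and last steps contribute 0. Ratios above
  \<open>T\<close> are dropped, not capped.\<close>

definition functional :: "real \<Rightarrow> nat \<Rightarrow> 'a \<Rightarrow> 'a \<Rightarrow> real" where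
  "functional T m w z =
    (if 0 < m \<and> m \<le> t \<and> ratio (m - 1) w z \<le> T then ratio (m - 1) w z else 0)"

section \<open>Moments of the truncated detour functional\<close>

lemma functional_Suc:
  "i < t \<Longrightarrow> functional T (Suc i) w z = (if ratio i w z \<le> T then ratio i w z else 0)"
  by (simp add: functional_def)

lemma functional_nonneg: "w \<in> V \<Longrightarrow> z \<in> V \<Longrightarrow> 0 \<le> functional T m w z"
  by (simp add: functional_def ratio_nonneg)

lemma functional_le_ratio:
  "w \<in> V \<Longrightarrow> z \<in> V \<Longrightarrow> functional T (Suc i) w z \<le> ratio i w z"
  by (simp add: functional_def ratio_nonneg)

text \<open>Summing out the turning vertex \<open>w\<close>: the ratio turns
  \<open>g (Suc i) w\<close> into at most \<open>h (Suc i) w * g i z / h i z\<close>, and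
  \<open>h_step\<close> sums the numerator to \<open>h i z\<close>. A detour thus cancels its own
  two steps.\<close>

lemma sum_functional_g:
  assumes i: "i < t" and z: "z \<in> V"
  shows "(\<Sum>w\<in>V. K z w * (functional T (Suc i) w z * g (Suc i) w)) \<le> g i z"
proof (cases "h i z = 0")
  case True
  hence "functional T (Suc i) w z = 0" for w using i by (simp add: functional_Suc ratio_def)
  thus ?thesis using g_nonneg[OF z] by simp
next
  case False
  hence hz: "h i z > 0" using h_nonneg[OF z, of i] by simp
  have "(\<Sum>w\<in>V. K z w * (functional T (Suc i) w z * g (Suc i) w))
      \<le> (\<Sum>w\<in>V. K z w * (h (Suc i) w * g i z / h i z))"
  proof (intro sum_mono mult_left_mono K_nonneg)
    fix w assume w: "w \<in> V"
    have "functional T (Suc i) w z * (g (Suc i) w * h i z) \<le> ratio i w z * (g (Suc i) w * h i z)"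
      by (intro mult_right_mono functional_le_ratio w z mult_nonneg_nonneg g_nonneg h_nonneg)
    also have "\<dots> \<le> h (Suc i) w * g i z" by (rule ratio_mult_le[OF w z])
    finally show "functional T (Suc i) w z * g (Suc i) w \<le> h (Suc i) w * g i z / h i z"
      using hz by (simp only: pos_le_divide_eq mult.assoc)
  qed
  also have "\<dots> = (\<Sum>w\<in>V. K z w * h (Suc i) w) * g i z / h i z"
    by (simp add: sum_distrib_right sum_divide_distrib mult.assoc)
  also have "\<dots> = g i z" using hz unfolding h_step[OF i, symmetric] by simp
  finally show ?thesis .
qed

text \<open>The same cancellation seen from the other end of the walk, with \<open>z\<close> summed
  out.\<close>

lemma sum_functional_h:
  assumes i: "i < t" and w: "w \<in> V"
  shows "(\<Sum>z\<in>V. K w z * (functional T (Suc i) w z * h i z)) \<le> h (Suc i) w"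
proof (cases "g (Suc i) w = 0")
  case True
  hence "functional T (Suc i) w z = 0" for z using i by (simp add: functional_Suc ratio_def)
  thus ?thesis using h_nonneg[OF w] by simp
next
  case False
  hence gw: "g (Suc i) w > 0" using g_nonneg[OF w, of "Suc i"] by simp
  have "(\<Sum>z\<in>V. K w z * (functional T (Suc i) w z * h i z))
      \<le> (\<Sum>z\<in>V. K w z * (h (Suc i) w * g i z / g (Suc i) w))"
  proof (intro sum_mono mult_left_mono K_nonneg)
    fix z assume z: "z \<in> V"
    have "functional T (Suc i) w z * (g (Suc i) w * h i z) \<le> ratio i w z * (g (Suc i) w * h i z)"
      by (intro mult_right_mono functional_le_ratio w z mult_nonneg_nonneg g_nonneg h_nonneg)
    also have "\<dots> \<le> h (Suc i) w * g i z" by (rule ratio_mult_le[OF w z])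
    finally show "functional T (Suc i) w z * h i z \<le> h (Suc i) w * g i z / g (Suc i) w"
      using gw by (simp only: pos_le_divide_eq mult_ac)
  qed
  also have "\<dots> = g (Suc i) w * h (Suc i) w / g (Suc i) w"
    by (simp add: sum_distrib_right sum_distrib_left sum_divide_distrib mult_ac)
  also have "\<dots> = h (Suc i) w" using gw by simp
  finally show ?thesis .
qed

lemma moment1_le:
  "m \<le> t \<Longrightarrow> z \<in> V \<Longrightarrow> moment1 (functional T) u (Suc m) z \<le> m * g (m - 1) z"
proof (induction m arbitrary: z)
  case 0
  show ?case by (simp add: functional_def)
next
  case (Suc m)
  have "moment1 (functional T) u (Suc (Suc m)) z
      = (\<Sum>w\<in>V. K z w * moment1 (functional T) u (Suc m) w)
        + (\<Sum>w\<in>V. K z w * (functional T (Suc m) w z * g (Suc m) w))"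
    by (simp only: moment1.simps(2)[of _ _ "Suc m"] distrib_left sum.distrib)
  also have "\<dots> \<le> (\<Sum>w\<in>V. K z w * (m * g (m - 1) w)) + g m z"
    using Suc.prems Suc.IH by (intro add_mono sum_mono mult_left_mono K_nonneg sum_functional_g) auto
  \<comment> \<open>For \<open>m = 0\<close> the cut-off index \<open>m - 1\<close> is multiplied by
    0.\<close>
  also have "(\<Sum>w\<in>V. K z w * (m * g (m - 1) w)) = m * g m z"
    by (cases m) (simp_all add: sum_distrib_left mult_ac)
  finally show ?case by (simp add: algebra_simps)
qed

lemma sum_interior:
  fixes f :: "nat \<Rightarrow> real"
  assumes "f 0 = 0" "f (Suc n) = 0"
  shows "(\<Sum>m<n + 2. f m) = (\<Sum>i<n. f (Suc i))"
proof -
  have "(\<Sum>m<n + 2. f m) = (\<Sum>m<Suc n. f m)" using assms by simp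
  also have "\<dots> = (\<Sum>i<n. f (Suc i))" unfolding sum.lessThan_Suc_shift using assms by simp
  finally show ?thesis .
qed

text \<open>Each untruncated detour contributes exactly \<open>q t\<close>, the total weight of its
  edge law; the subtracted term bounds what truncation removes.\<close>

lemma measured_moment1:
  assumes T: "1 < T"
  shows "t * q t - q t * (2 * ln (card V / q t) + 2 * t) / ln T
    \<le> measured v (moment1 (functional T) u (t + 2))"
proof -
  have "measured v (moment1 (functional T) u (t + 2))
    = (\<Sum>m<t + 2. \<Sum>w\<in>V. \<Sum>z\<in>V. K w z * (heat (t + 2 - 1 - m) v z * (functional T m w z * g m w)))"
    by (rule measured_recursion) auto
  also have "\<dots> = (\<Sum>i<t. \<Sum>w\<in>V. \<Sum>z\<in>V. K w z * (h i z * (functional T (Suc i) w z * g (Suc i) w)))"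
    by (subst sum_interior) (simp_all add: functional_def del: heat.simps)
  also have "\<dots> = (\<Sum>i<t. \<Sum>w\<in>V. \<Sum>z\<in>V. K w z * (h (Suc i) w * g i z)
      - K w z * (h (Suc i) w * g i z) * of_bool (T < ratio i w z))"
  proof (intro sum.cong refl)
    fix i w z assume i: "i \<in> {..<t}" and w: "w \<in> V" and z: "z \<in> V"
    show "K w z * (h i z * (functional T (Suc i) w z * g (Suc i) w))
      = K w z * (h (Suc i) w * g i z) - K w z * (h (Suc i) w * g i z) * of_bool (T < ratio i w z)"
    proof (cases "K w z = 0 \<or> T < ratio i w z")
      case True
      thus ?thesis using i by (auto simp: functional_Suc)
    next
      case False
      hence K: "K w z > 0" using K_nonneg[of w z] by simp
      \<comment> \<open>On an edge of positive weight the denominator vanishes only where the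
        numerator does, so the cancellation is exact.\<close>
      have "h i z * (ratio i w z * g (Suc i) w) = h (Suc i) w * g i z"
      proof (cases "h (Suc i) w = 0 \<or> g i z = 0")
        case True
        thus ?thesis by (auto simp: ratio_def)
      next
        case False
        hence "h (Suc i) w > 0" "g i z > 0"
          using h_nonneg[OF w, of "Suc i"] g_nonneg[OF z, of i] by auto
        hence "h i z > 0" "g (Suc i) w > 0" using h_pos[OF _ w z K] g_pos[OF w z K] i by auto
        thus ?thesis unfolding ratio_def by (simp del: heat.simps)
      qed
      thus ?thesis using False i by (simp add: functional_Suc del: heat.simps)
    qed
  qed
  also have "\<dots> = (\<Sum>i<t. q t)
      - (\<Sum>i<t. \<Sum>w\<in>V. \<Sum>z\<in>V. K w z * (h (Suc i) w * g i z) * of_bool (T < ratio i w z))"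
    unfolding sum_subtractf by (simp add: edge_sum del: heat.simps)
  also have "\<dots> \<ge> (\<Sum>i<t. q t) - q t * (2 * ln (card V / q t) + 2 * t) / ln T"
    using truncated_mass[OF T] T by (intro diff_left_mono) (simp add: pos_le_divide_eq)
  finally show ?thesis by simp
qed

text \<open>For two distinct detours, \<open>moment1_le\<close> cancels the earlier and
  \<open>sum_functional_h\<close> the later, leaving \<open>t - 2\<close> steps. On the diagonal,
  truncation bounds the square by \<open>T\<close> times the ratio.\<close>

lemma measured_moment2:
  assumes T: "1 < T"
  shows "measured v (moment2 (functional T) u (t + 2)) \<le> (real t)\<^sup>2 * q (t - 2) + t * (T * q t)"
proof -
  let ?\<psi> = "functional T"
  have cross: "(\<Sum>w\<in>V. \<Sum>z\<in>V. K w z * (h i z * (2 * ?\<psi> (Suc i) w z * moment1 ?\<psi> u (Suc i) w)))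
      \<le> 2 * real i * q (t - 2)" if i: "i < t" for i
  proof -
    have "(\<Sum>w\<in>V. \<Sum>z\<in>V. K w z * (h i z * (2 * ?\<psi> (Suc i) w z * moment1 ?\<psi> u (Suc i) w)))
      \<le> (\<Sum>w\<in>V. \<Sum>z\<in>V. K w z * (h i z * (2 * ?\<psi> (Suc i) w z * (i * g (i - 1) w))))"
      using i by (intro sum_mono mult_left_mono K_nonneg h_nonneg mult_nonneg_nonneg functional_nonneg
          moment1_le) auto
    also have "\<dots> = (\<Sum>w\<in>V. (2 * real i * g (i - 1) w) * (\<Sum>z\<in>V. K w z * (?\<psi> (Suc i) w z * h i z)))"
      by (simp add: sum_distrib_left mult_ac)
    also have "\<dots> \<le> (\<Sum>w\<in>V. (2 * real i * g (i - 1) w) * h (Suc i) w)"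
      by (intro sum_mono mult_left_mono sum_functional_h i mult_nonneg_nonneg g_nonneg) auto
    also have "\<dots> = 2 * real i * measured (g (i - 1)) (h (Suc i))"
      by (simp add: measured_def sum_distrib_left mult_ac)
    also have "\<dots> = 2 * real i * q (t - 2)"
    proof (cases i)
      case (Suc j)
      thus ?thesis using i by (simp add: measured_heat_heat numeral_2_eq_2 Suc_diff_Suc del: heat.simps)
    qed simp
    finally show ?thesis by (simp del: heat.simps moment1.simps)
  qed
  have diag: "(\<Sum>w\<in>V. \<Sum>z\<in>V. K w z * (h i z * ((?\<psi> (Suc i) w z)\<^sup>2 * g (Suc i) w))) \<le> T * q t"
    if i: "i < t" for i
  proof -
    have "(\<Sum>w\<in>V. \<Sum>z\<in>V. K w z * (h i z * ((?\<psi> (Suc i) w z)\<^sup>2 * g (Suc i) w)))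
      \<le> (\<Sum>w\<in>V. \<Sum>z\<in>V. K w z * (T * (h (Suc i) w * g i z)))"
    proof (intro sum_mono mult_left_mono K_nonneg)
      fix w z assume w: "w \<in> V" and z: "z \<in> V"
      have n: "0 \<le> g (Suc i) w * h i z" by (intro mult_nonneg_nonneg g_nonneg h_nonneg w z)
      have "h i z * ((?\<psi> (Suc i) w z)\<^sup>2 * g (Suc i) w)
        = ?\<psi> (Suc i) w z * (?\<psi> (Suc i) w z * (g (Suc i) w * h i z))"
        by (simp add: power2_eq_square mult_ac del: heat.simps)
      also have "\<dots> \<le> T * (ratio i w z * (g (Suc i) w * h i z))"
        using T i by (intro mult_mono mult_nonneg_nonneg[OF _ n] mult_right_mono[OF _ n]
            functional_le_ratio functional_nonneg w z) (auto simp: functional_Suc)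
      also have "\<dots> \<le> T * (h (Suc i) w * g i z)"
        using T by (intro mult_left_mono ratio_mult_le w z) auto
      finally show "h i z * ((?\<psi> (Suc i) w z)\<^sup>2 * g (Suc i) w) \<le> T * (h (Suc i) w * g i z)" .
    qed
    also have "\<dots> = T * (\<Sum>w\<in>V. \<Sum>z\<in>V. K w z * (h (Suc i) w * g i z))"
      by (simp add: sum_distrib_left mult_ac del: heat.simps)
    finally show ?thesis by (simp only: edge_sum[OF i])
  qed
  have "measured v (moment2 ?\<psi> u (t + 2))
    = (\<Sum>m<t + 2. \<Sum>w\<in>V. \<Sum>z\<in>V. K w z * (heat (t + 2 - 1 - m) v z *
        (2 * ?\<psi> m w z * moment1 ?\<psi> u m w + (?\<psi> m w z)\<^sup>2 * g m w)))"
    by (rule measured_recursion) auto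
  also have "\<dots> = (\<Sum>i<t. \<Sum>w\<in>V. \<Sum>z\<in>V. K w z * (h i z *
        (2 * ?\<psi> (Suc i) w z * moment1 ?\<psi> u (Suc i) w + (?\<psi> (Suc i) w z)\<^sup>2 * g (Suc i) w)))"
    by (subst sum_interior) (simp_all add: functional_def del: heat.simps moment1.simps)
  also have "\<dots> = (\<Sum>i<t. (\<Sum>w\<in>V. \<Sum>z\<in>V. K w z * (h i z * (2 * ?\<psi> (Suc i) w z * moment1 ?\<psi> u (Suc i) w)))
      + (\<Sum>w\<in>V. \<Sum>z\<in>V. K w z * (h i z * ((?\<psi> (Suc i) w z)\<^sup>2 * g (Suc i) w))))"
    by (simp only: distrib_left sum.distrib)
  also have "\<dots> \<le> (\<Sum>i<t. 2 * real i * q (t - 2) + T * q t)"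
    by (intro sum_mono add_mono cross diag) (simp_all only: lessThan_iff)
  also have "\<dots> = (\<Sum>i<t. 2 * real i) * q (t - 2) + t * (T * q t)"
    by (simp add: sum.distrib sum_distrib_right)
  \<comment> \<open>This counts ordered pairs of distinct detours. For \<open>t = 1\<close> there
    are none, so the cut-off value \<open>t - 2 = 0\<close> is harmless.\<close>
  also have "(\<Sum>i<t. 2 * real i) \<le> (real t)\<^sup>2"
    by (induction t) (auto simp: power2_eq_square algebra_simps)
  finally show ?thesis using q_nonneg by (simp add: mult_right_mono)
qed

text \<open>The nonnegative quadratic is taken at \<open>t * c\<close>, integrated against
  \<open>v\<close> and divided by the square of \<open>t\<close>.\<close>

theorem near_log_convexity:
  fixes T c :: real
  assumes T: "1 < T" and t: "0 < t" and c: "0 \<le> c"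
  shows "2 * c * (1 - (2 * ln (card V / q t) + 2 * t) / (t * ln T)) * q t
    \<le> c\<^sup>2 * q (t + 2) + q (t - 2) + T / t * q t"
proof -
  let ?I1 = "measured v (moment1 (functional T) u (t + 2))"
  let ?I2 = "measured v (moment2 (functional T) u (t + 2))"
  define X where "X = 2 * ln (card V / q t) + 2 * t"
  have "0 \<le> measured v (\<lambda>z. (t * c)\<^sup>2 * heat (t + 2) u z
      - 2 * (t * c) * moment1 (functional T) u (t + 2) z + moment2 (functional T) u (t + 2) z)"
    unfolding measured_def by (intro sum_nonneg mult_nonneg_nonneg moment_quadratic_nonneg u_nonneg v_nonneg)
  also have "\<dots> = (t * c)\<^sup>2 * measured v (heat (t + 2) u) - 2 * (t * c) * ?I1 + ?I2"
    unfolding measured_def sum_distrib_left sum_subtractf[symmetric] sum.distrib[symmetric]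
    by (intro sum.cong refl) (simp add: algebra_simps)
  also have "measured v (heat (t + 2) u) = q (t + 2)"
    using measured_heat_heat[of "t + 2" u 0 v] measured_commute[of v "heat (t + 2) u"]
    by (simp add: measured_def)
  finally have "2 * (t * c) * ?I1 \<le> (t * c)\<^sup>2 * q (t + 2) + ?I2" by linarith
  moreover have "2 * (t * c) * (t * q t - q t * X / ln T) \<le> 2 * (t * c) * ?I1"
    using measured_moment1[OF T] c unfolding X_def by (intro mult_left_mono) auto
  ultimately have "2 * (t * c) * (t * q t - q t * X / ln T)
      \<le> (t * c)\<^sup>2 * q (t + 2) + (real t)\<^sup>2 * q (t - 2) + t * (T * q t)"
    using measured_moment2[OF T] by linarith
  hence "(2 * (t * c) * (t * q t - q t * X / ln T)) / (real t)\<^sup>2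
      \<le> ((t * c)\<^sup>2 * q (t + 2) + (real t)\<^sup>2 * q (t - 2) + t * (T * q t)) / (real t)\<^sup>2"
    by (rule divide_right_mono) simp
  also have "(2 * (t * c) * (t * q t - q t * X / ln T)) / (real t)\<^sup>2
      = 2 * c * (1 - X / (t * ln T)) * q t"
    using t T by (simp add: power2_eq_square field_simps)
  also have "((t * c)\<^sup>2 * q (t + 2) + (real t)\<^sup>2 * q (t - 2) + t * (T * q t)) / (real t)\<^sup>2
      = c\<^sup>2 * q (t + 2) + q (t - 2) + T / t * q t"
    using t by (simp add: power2_eq_square add_divide_distrib)
  finally show ?thesis unfolding X_def .
qed

end

section \<open>Protocol trees\<close>

context symmetric_substochastic
begin

section \<open>Masses of functions of both endpoints, and protocols\<close>

definition kernel_power :: "nat \<Rightarrow> 'v \<Rightarrow> 'v \<Rightarrow> real" where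
  "kernel_power s x y = heat s (\<lambda>z. of_bool (z = y)) x"

lemma heat_eq_sum_kernel_power:
  "x \<in> V \<Longrightarrow> heat s f x = (\<Sum>y\<in>V. kernel_power s x y * f y)"
proof (induction s arbitrary: x)
  case 0
  have "(\<Sum>y\<in>V. kernel_power 0 x y * f y) = (\<Sum>y\<in>V. if x = y then f y else 0)"
    by (intro sum.cong refl) (simp add: kernel_power_def)
  thus ?case using finite_V 0 by simp
next
  case (Suc s)
  have "heat (Suc s) f x = (\<Sum>z\<in>V. \<Sum>y\<in>V. K x z * (kernel_power s z y * f y))"
    by (simp add: Suc.IH sum_distrib_left)
  also have "\<dots> = (\<Sum>y\<in>V. \<Sum>z\<in>V. K x z * (kernel_power s z y * f y))"
    by (rule sum.swap)
  finally show ?case by (simp add: kernel_power_def sum_distrib_right mult.assoc)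
qed

definition mass :: "nat \<Rightarrow> ('v \<Rightarrow> 'v \<Rightarrow> real) \<Rightarrow> real" where
  "mass s F = (\<Sum>x\<in>V. \<Sum>y\<in>V. kernel_power s x y * F x y)"

lemma mass_eq_heat: "mass s F = (\<Sum>x\<in>V. heat s (F x) x)"
  unfolding mass_def by (simp add: heat_eq_sum_kernel_power)

lemma mass_add: "mass s (\<lambda>x y. F x y + G x y) = mass s F + mass s G"
  unfolding mass_def by (simp add: algebra_simps sum.distrib)

lemma mass_product: "mass s (\<lambda>x y. a x * b y) = measured a (heat s b)"
  unfolding mass_eq_heat measured_def by (simp add: heat_cmult)

lemma mass_nonneg: "(\<And>x y. 0 \<le> F x y) \<Longrightarrow> 0 \<le> mass s F"
  unfolding mass_eq_heat by (intro sum_nonneg heat_nonneg) auto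

lemma mass_le_card:
  assumes "\<And>x y. F x y \<le> 1"
  shows "mass s F \<le> card V"
proof -
  have "mass s F \<le> (\<Sum>x\<in>V. 1)"
    unfolding mass_eq_heat by (intro sum_mono heat_le_1 assms)
  thus ?thesis by simp
qed

text \<open>Every node splits the rectangle \<open>A\<close>, \<open>B\<close> into two and all
  masses add up, so only leaves matter; the error term pays once for each of at most
  \<open>2 ^ depth \<tau>\<close> leaves.\<close>

lemma protocol_tree_bound:
  fixes \<tau> :: ptree and ex ey :: "'v \<Rightarrow> bool list" and T c \<epsilon> \<eta> :: real and t :: nat
  assumes T: "1 < T" and t: "0 < t" and c: "0 \<le> c" and \<epsilon>: "0 < \<epsilon>" and \<eta>: "0 \<le> \<eta>" "\<eta> \<le> 1"
    and L: "(2 * ln (1 / \<epsilon>) + 2 * t) / (t * ln T) \<le> \<eta>"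
  defines "R \<equiv> \<lambda>\<tau> A B x y. of_bool (x \<in> A \<and> y \<in> B \<and> run \<tau> (ex x) (ey y)) :: real"
  shows "2 * c * (1 - \<eta>) * mass t (R \<tau> A B) \<le>
    c\<^sup>2 * mass (t + 2) (R \<tau> A B) + mass (t - 2) (R \<tau> A B) + T / t * mass t (R \<tau> A B)
    + 2 ^ depth \<tau> * (2 * c * \<epsilon> * card V)"
proof -
  have split: "2 * c * (1 - \<eta>) * mass t (R \<tau> A B) \<le>
    c\<^sup>2 * mass (t + 2) (R \<tau> A B) + mass (t - 2) (R \<tau> A B) + T / t * mass t (R \<tau> A B)
    + 2 ^ Suc (max (depth l) (depth r)) * (2 * c * \<epsilon> * card V)"
    if R: "R \<tau> A B = (\<lambda>x y. R l A' B' x y + R r A'' B'' x y)"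
      and l: "2 * c * (1 - \<eta>) * mass t (R l A' B') \<le>
        c\<^sup>2 * mass (t + 2) (R l A' B') + mass (t - 2) (R l A' B') + T / t * mass t (R l A' B')
        + 2 ^ depth l * (2 * c * \<epsilon> * card V)"
      and r: "2 * c * (1 - \<eta>) * mass t (R r A'' B'') \<le>
        c\<^sup>2 * mass (t + 2) (R r A'' B'') + mass (t - 2) (R r A'' B'') + T / t * mass t (R r A'' B'')
        + 2 ^ depth r * (2 * c * \<epsilon> * card V)"
    for \<tau> l r A A' A'' B B' B''
  proof -
    define Z where "Z = 2 * c * \<epsilon> * card V"
    have Z: "0 \<le> Z" using c \<epsilon> by (simp add: Z_def)
    have "2 ^ depth l * Z + 2 ^ depth r * Z
        \<le> 2 ^ max (depth l) (depth r) * Z + 2 ^ max (depth l) (depth r) * Z"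
      using Z by (intro add_mono mult_right_mono power_increasing) auto
    thus ?thesis using l r unfolding R mass_add Z_def[symmetric] by (simp add: algebra_simps)
  qed
  show ?thesis
  proof (induction \<tau> arbitrary: A B)
    case (Leaf b)
    define q where "q s = mass s (R (Leaf b) A B)" for s
    have q_nonneg: "0 \<le> q s" for s unfolding q_def by (rule mass_nonneg) (simp add: R_def)
    have rest: "0 \<le> c\<^sup>2 * q (t + 2) + q (t - 2) + T / t * q t"
      using q_nonneg T by (intro add_nonneg_nonneg mult_nonneg_nonneg divide_nonneg_nonneg) auto
    have "2 * c * (1 - \<eta>) * q t \<le> c\<^sup>2 * q (t + 2) + q (t - 2) + T / t * q t + 2 * c * \<epsilon> * card V"
    \<comment> \<open>A heavy accepting leaf obeys near log-convexity with loss at most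
      \<open>\<eta>\<close>; any other leaf has a left side of at most
      \<open>2 * c * \<epsilon> * card V\<close>.\<close>
    proof (cases "b \<and> 0 < q t \<and> \<epsilon> * card V \<le> q t")
      case True
      have q: "q s = measured (\<lambda>x. of_bool (x \<in> A)) (heat s (\<lambda>x. of_bool (x \<in> B)))" for s
        unfolding q_def mass_product[symmetric] by (simp add: R_def of_bool_conj True)
      interpret measured_heat V K "\<lambda>x. of_bool (x \<in> A)" "\<lambda>x. of_bool (x \<in> B)" t
        using True by unfold_locales (auto simp: q)
      have "ln (card V / q t) \<le> ln (1 / \<epsilon>)"
        using True \<epsilon> card_V_pos by (simp add: field_simps)
      hence "(2 * ln (card V / q t) + 2 * t) / (t * ln T) \<le> (2 * ln (1 / \<epsilon>) + 2 * t) / (t * ln T)"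
        using T by (intro divide_right_mono) auto
      hence "1 - \<eta> \<le> 1 - (2 * ln (card V / q t) + 2 * t) / (t * ln T)" using L by linarith
      hence "2 * c * (1 - \<eta>) * q t
          \<le> 2 * c * (1 - (2 * ln (card V / q t) + 2 * t) / (t * ln T)) * q t"
        using c True by (intro mult_right_mono mult_left_mono) auto
      also have "\<dots> \<le> c\<^sup>2 * q (t + 2) + q (t - 2) + T / t * q t"
        using near_log_convexity[OF T t c] unfolding q .
      also have "\<dots> \<le> \<dots> + 2 * c * \<epsilon> * card V" using c \<epsilon> by simp
      finally show ?thesis .
    next
      case False
      have "q t \<le> \<epsilon> * card V"
      proof (cases b)
        case True
        thus ?thesis using False \<epsilon> q_nonneg[of t] by (auto simp: not_le not_less intro: order_trans)
      next
        case b: False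
        have "q t = 0" unfolding q_def R_def mass_def using b by simp
        thus ?thesis using \<epsilon> by simp
      qed
      have "(1 - \<eta>) * q t \<le> 1 * (\<epsilon> * card V)"
        using \<open>q t \<le> _\<close> \<eta> q_nonneg[of t] by (intro mult_mono) auto
      hence "2 * c * ((1 - \<eta>) * q t) \<le> 2 * c * (1 * (\<epsilon> * card V))"
        using c by (intro mult_left_mono) auto
      thus ?thesis using rest by (simp add: mult.assoc)
    qed
    thus ?case by (simp add: q_def)
  next
    case (ANode f l r)
    have "R (ANode f l r) A B
        = (\<lambda>x y. R l {x \<in> A. \<not> f (ex x)} B x y + R r {x \<in> A. f (ex x)} B x y)"
      by (intro ext) (auto simp: R_def)
    from split[OF this ANode.IH] show ?case by simp
  next
    case (BNode f l r)
    have "R (BNode f l r) A B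
        = (\<lambda>x y. R l A {y \<in> B. \<not> f (ey y)} x y + R r A {y \<in> B. f (ey y)} x y)"
      by (intro ext) (auto simp: R_def)
    from split[OF this BNode.IH] show ?case by simp
  qed
qed

text \<open>The tree bound is linear in the acceptance indicator, with coefficients
  \<open>w\<close>, so it can be averaged over the public coins.\<close>

lemma randomized_protocol_bound:
  fixes P :: rprotocol and ex ey :: "'v \<Rightarrow> bool list" and T c \<epsilon> \<eta> :: real and t :: nat
  assumes T: "1 < T" and t: "0 < t" and c: "0 \<le> c" and \<epsilon>: "0 < \<epsilon>" and \<eta>: "0 \<le> \<eta>" "\<eta> \<le> 1"
    and L: "(2 * ln (1 / \<epsilon>) + 2 * t) / (t * ln T) \<le> \<eta>"
    and cost: "cost_le P d"
  defines "p \<equiv> \<lambda>x y. measure_pmf.prob P {\<tau>. run \<tau> (ex x) (ey y)}"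
  shows "2 * c * (1 - \<eta>) * mass t p \<le>
    c\<^sup>2 * mass (t + 2) p + mass (t - 2) p + T / t * mass t p + 2 ^ d * (2 * c * \<epsilon> * card V)"
proof -
  define R where "R \<tau> x y = (of_bool (run \<tau> (ex x) (ey y)) :: real)" for \<tau> x y
  define w where "w x y = c\<^sup>2 * kernel_power (t + 2) x y + kernel_power (t - 2) x y
    + T / t * kernel_power t x y - 2 * c * (1 - \<eta>) * kernel_power t x y" for x y
  have w: "(\<Sum>x\<in>V. \<Sum>y\<in>V. w x y * F x y) = c\<^sup>2 * mass (t + 2) F + mass (t - 2) F + T / t * mass t F
      - 2 * c * (1 - \<eta>) * mass t F" for F
    unfolding mass_def w_def sum_distrib_left sum_subtractf[symmetric] sum.distrib[symmetric]
    by (intro sum.cong refl) (simp add: algebra_simps)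
  define Z where "Z = 2 * c * \<epsilon> * card V"
  have Z: "0 \<le> Z" using c \<epsilon> by (simp add: Z_def)
  have "0 \<le> (\<Sum>x\<in>V. \<Sum>y\<in>V. w x y * R \<tau> x y) + 2 ^ d * Z" if "\<tau> \<in> set_pmf P" for \<tau>
  proof -
    have "2 ^ depth \<tau> * Z \<le> 2 ^ d * Z"
      using cost that Z by (intro mult_right_mono power_increasing) (auto simp: cost_le_def)
    thus ?thesis
      using protocol_tree_bound[OF T t c \<epsilon> \<eta> L, where \<tau> = \<tau> and A = UNIV and B = UNIV and ex = ex and ey = ey] unfolding w R_def Z_def by simp
  qed
  hence "0 \<le> measure_pmf.expectation P (\<lambda>\<tau>. (\<Sum>x\<in>V. \<Sum>y\<in>V. w x y * R \<tau> x y) + 2 ^ d * Z)"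
    by (intro integral_nonneg_AE AE_pmfI)
  moreover have "integrable (measure_pmf P) (\<lambda>\<tau>. R \<tau> x y)" for x y
    by (rule measure_pmf.integrable_const_bound[where B = 1]) (auto simp: R_def)
  moreover have "measure_pmf.expectation P (\<lambda>\<tau>. R \<tau> x y) = p x y" for x y
  proof -
    have "(\<lambda>\<tau>. R \<tau> x y) = indicator {\<tau>. run \<tau> (ex x) (ey y)}"
      by (auto simp: R_def fun_eq_iff)
    thus ?thesis by (simp add: p_def)
  qed
  ultimately have "0 \<le> (\<Sum>x\<in>V. \<Sum>y\<in>V. w x y * p x y) + 2 ^ d * Z" by simp
  thus ?thesis unfolding w Z_def by simp
qed

end

section \<open>Walks on the Hamming cube\<close>

definition flip :: "nat \<Rightarrow> bool list \<Rightarrow> bool list" where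
  "flip j x = x[j := \<not> x ! j]"

definition cube :: "nat \<Rightarrow> bool list set" where
  "cube n = {x. length x = n}"

definition cube_kernel :: "nat \<Rightarrow> bool list \<Rightarrow> bool list \<Rightarrow> real" where
  "cube_kernel n x y = (\<Sum>j<n. of_bool (y = flip j x)) / n"

lemma finite_cube: "finite (cube n)"
  using finite_lists_length_eq[of "UNIV :: bool set" n] by (simp add: cube_def)

lemma flip_in_cube: "x \<in> cube n \<Longrightarrow> flip j x \<in> cube n"
  by (simp add: flip_def cube_def)

lemma flip_flip: "flip j (flip j x) = x"
  by (cases "j < length x") (simp_all add: flip_def list_update_beyond)

lemma cube_kernel_sum:
  assumes "x \<in> cube n"
  shows "(\<Sum>y\<in>cube n. cube_kernel n x y * f y) = (\<Sum>j<n. f (flip j x)) / n"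
proof -
  have "(\<Sum>y\<in>cube n. cube_kernel n x y * f y)
      = (\<Sum>y\<in>cube n. \<Sum>j<n. if y = flip j x then f y else 0) / n"
    unfolding cube_kernel_def sum_divide_distrib sum_distrib_right
    by (intro sum.cong refl) simp
  also have "(\<Sum>y\<in>cube n. \<Sum>j<n. if y = flip j x then f y else 0)
      = (\<Sum>j<n. \<Sum>y\<in>cube n. if y = flip j x then f y else 0)"
    by (rule sum.swap)
  also have "\<dots> = (\<Sum>j<n. f (flip j x))"
    using finite_cube flip_in_cube[OF assms] by simp
  finally show ?thesis .
qed

lemma cube_kernel_sum_1: "0 < n \<Longrightarrow> x \<in> cube n \<Longrightarrow> (\<Sum>y\<in>cube n. cube_kernel n x y) = 1"
  using cube_kernel_sum[of x n "\<lambda>_. 1"] by simp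

lemma symmetric_substochastic_cube:
  assumes "0 < n"
  shows "symmetric_substochastic (cube n) (cube_kernel n)"
proof
  show "finite (cube n)" by (rule finite_cube)
  show "0 \<le> cube_kernel n x y" for x y
    unfolding cube_kernel_def by (intro divide_nonneg_nonneg sum_nonneg) auto
  show "cube_kernel n x y = cube_kernel n y x" for x y
  proof -
    have "y = flip j x \<longleftrightarrow> x = flip j y" for j using flip_flip by metis
    thus ?thesis by (simp add: cube_kernel_def)
  qed
  show "(\<Sum>y\<in>cube n. cube_kernel n x y) \<le> 1" if "x \<in> cube n" for x
    using cube_kernel_sum_1[OF assms that] by simp
qed

lemma hamming_flip:
  assumes "x \<in> cube n" "y \<in> cube n" "j < n" "x ! j = y ! j"
  shows "hamming x (flip j y) = Suc (hamming x y)"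
proof -
  have "{i. i < length x \<and> i < length (flip j y) \<and> x ! i \<noteq> flip j y ! i}
      = insert j {i. i < length x \<and> i < length y \<and> x ! i \<noteq> y ! i}"
    using assms by (auto simp: flip_def cube_def nth_list_update)
  thus ?thesis using assms by (simp add: hamming_def)
qed

lemma card_agreements:
  assumes "x \<in> cube n" "y \<in> cube n"
  shows "real (card {j. j < n \<and> x ! j = y ! j}) = real n - real (hamming x y)"
proof -
  have "card {j. j < n \<and> x ! j = y ! j} + card {j. j < n \<and> x ! j \<noteq> y ! j} = card {..<n}"
    by (subst card_Un_disjoint[symmetric]) (auto intro!: arg_cong[where f = card] simp del: card_lessThan)
  moreover have "hamming x y = card {j. j < n \<and> x ! j \<noteq> y ! j}"
    using assms by (auto simp: hamming_def cube_def intro!: arg_cong[where f = card])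
  ultimately show ?thesis by simp
qed

text \<open>A walk at distance \<open>j\<close> after \<open>j\<close> steps next flips a coordinate
  already changed with probability \<open>j / n\<close>; these failures are summed.\<close>

lemma walk_distance:
  assumes n: "0 < n" and x: "x \<in> cube n"
  shows "1 - real s ^ 2 / (2 * n) \<le> symmetric_substochastic.heat (cube n) (cube_kernel n) s
    (\<lambda>y. of_bool (hamming x y = s)) x"
proof -
  interpret symmetric_substochastic "cube n" "cube_kernel n"
    by (rule symmetric_substochastic_cube[OF n])
  have "1 - (\<Sum>j<s. real j / n) \<le> heat s (\<lambda>y. of_bool (hamming x y = s)) x"
  proof (induction s)
    case 0
    show ?case by (simp add: hamming_def)
  next
    case (Suc s)
    let ?D = "\<lambda>s. heat s (\<lambda>y. of_bool (hamming x y = s)) x"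
    have step: "of_bool (hamming x y = s) + (- (s / n)) * of_bool (hamming x y = s)
        \<le> (\<Sum>z\<in>cube n. cube_kernel n y z * of_bool (hamming x z = Suc s))" if y: "y \<in> cube n" for y
    proof (cases "hamming x y = s")
      case True
      have "real n - s = (\<Sum>j\<in>{j. j < n \<and> x ! j = y ! j}. 1)"
        using card_agreements[OF x y] True by simp
      also have "\<dots> \<le> (\<Sum>j<n. of_bool (hamming x (flip j y) = Suc s))"
        using hamming_flip[OF x y] True by (intro sum_le_included[where i = id]) auto
      finally have "(real n - s) / n \<le> (\<Sum>j<n. of_bool (hamming x (flip j y) = Suc s)) / n"
        by (rule divide_right_mono) simp
      thus ?thesis using True n by (simp add: cube_kernel_sum[OF y] diff_divide_distrib)
    next
      case False
      thus ?thesis by (simp add: sum_nonneg K_nonneg)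
    qed
    have le1: "?D s \<le> 1" by (intro heat_le_1 x) auto
    have "?D s + (- (s / n)) * ?D s \<le> ?D (Suc s)"
      \<comment> \<open>The last step is peeled off, which keeps the starting point \<open>x\<close>
        fixed.\<close>
      unfolding heat_Suc_right heat_cmult[symmetric] heat_add[OF x, symmetric]
      by (intro heat_mono x step)
    moreover have "(s / n) * ?D s \<le> (s / n) * 1" by (intro mult_left_mono le1) auto
    ultimately show ?case using Suc by (simp del: heat.simps)
  qed
  moreover have "(\<Sum>j<s. real j / n) \<le> real s ^ 2 / (2 * n)"
  proof -
    have "2 * (\<Sum>j<s. real j) \<le> real s ^ 2"
      by (induction s) (auto simp: power2_eq_square algebra_simps)
    thus ?thesis using n by (simp add: sum_divide_distrib[symmetric] field_simps)
  qed
  ultimately show ?thesis by linarith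
qed

text \<open>This padding fixes \<open>d\<close> differences in advance, lowering the threshold by
  \<open>d\<close>.\<close>

lemma hamming_append:
  assumes "length x = length y"
  shows "hamming (x @ replicate d False) (y @ replicate d True) = hamming x y + d"
proof -
  have "{i. i < length (x @ replicate d False) \<and> i < length (y @ replicate d True)
         \<and> (x @ replicate d False) ! i \<noteq> (y @ replicate d True) ! i}
      = {i. i < length x \<and> i < length y \<and> x ! i \<noteq> y ! i} \<union> {length x..<length x + d}"
    using assms by (auto simp: nth_append)
  also have "card \<dots> = hamming x y + d"
    unfolding hamming_def by (subst card_Un_disjoint) auto
  finally show ?thesis by (simp add: hamming_def)
qed

text \<open>The walk has distance exactly its length up to probability \<open>\<zeta>\<close>, so
  correctness puts acceptance near 1 after \<open>t\<close> steps and near 0 after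
  \<open>t + 2\<close>; the remaining masses are bounded by \<open>N\<close>.\<close>

lemma walk_protocol_bound:
  fixes P :: rprotocol and T \<delta> \<zeta> \<epsilon> \<eta> \<kappa> :: real and t n c d :: nat
  assumes n: "0 < n" and T: "1 < T" and t: "0 < t" and \<kappa>: "0 < \<kappa>"
    and \<epsilon>: "0 < \<epsilon>" and \<eta>: "0 \<le> \<eta>" "\<eta> \<le> 1"
    and L: "(2 * ln (1 / \<epsilon>) + 2 * t) / (t * ln T) \<le> \<eta>"
    and cost: "cost_le P c" and \<delta>: "0 < \<delta>" "\<delta> \<le> 1"
    and \<zeta>: "(t + 2)\<^sup>2 / (2 * n) \<le> \<zeta>"
    and err: "\<And>x y. x \<in> cube n \<Longrightarrow> y \<in> cube n \<Longrightarrow> hamming x y \<in> {t, t + 2} \<Longrightarrow>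
       err_prob P (Ham (t + d)) (x @ replicate d False) (y @ replicate d True) \<le> \<delta>"
  shows "2 * \<kappa> * (1 - \<eta>) * (1 - \<delta> - \<zeta>) \<le> \<kappa>\<^sup>2 * (\<delta> + \<zeta>) + 1 + T / t + 2 ^ c * (2 * \<kappa> * \<epsilon>)"
proof -
  interpret symmetric_substochastic "cube n" "cube_kernel n"
    by (rule symmetric_substochastic_cube[OF n])
  define p where "p x y = measure_pmf.prob P
    {\<tau>. run \<tau> (x @ replicate d False) (y @ replicate d True)}" for x y
  have p01: "0 \<le> p x y" "p x y \<le> 1" for x y by (auto simp: p_def)
  define N where "N = real (card (cube n))"
  have "replicate n False \<in> cube n" by (simp add: cube_def)
  hence N: "N > 0" unfolding N_def using finite_cube[of n] by (auto simp: card_gt_0_iff)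
  have dist: "1 - \<zeta> \<le> heat s (\<lambda>y. of_bool (hamming x y = s)) x" if "x \<in> cube n" "s \<le> t + 2" for x s
  proof -
    have "real s ^ 2 / (2 * n) \<le> (t + 2)\<^sup>2 / (2 * n)"
      using that by (intro divide_right_mono) (auto simp flip: of_nat_power intro!: power_mono)
    thus ?thesis using walk_distance[OF n that(1), of s] \<zeta> by linarith
  qed
  have "0 \<le> \<zeta>" using \<zeta> by (rule order_trans[rotated]) simp
  have lower: "1 - \<delta> \<le> p x y" if "x \<in> cube n" "y \<in> cube n" "hamming x y = t" for x y
  proof -
    have "Ham (t + d) (x @ replicate d False) (y @ replicate d True)"
      using that by (simp add: Ham_def hamming_append cube_def)
    hence "err_prob P (Ham (t + d)) (x @ replicate d False) (y @ replicate d True)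
        = measure_pmf.prob P (- {\<tau>. run \<tau> (x @ replicate d False) (y @ replicate d True)})"
      by (auto simp: err_prob_def intro!: arg_cong[where f = "measure_pmf.prob P"])
    also have "\<dots> = 1 - p x y"
      unfolding p_def using measure_pmf.prob_compl[of "{\<tau>. run \<tau> (x @ replicate d False) (y @ replicate d True)}" P]
      by (simp add: Compl_eq_Diff_UNIV)
    finally show ?thesis using err[of x y] that by simp
  qed
  have upper: "p x y \<le> \<delta>" if "x \<in> cube n" "y \<in> cube n" "hamming x y = t + 2" for x y
  proof -
    have "\<not> Ham (t + d) (x @ replicate d False) (y @ replicate d True)"
      using that by (simp add: Ham_def hamming_append cube_def)
    thus ?thesis using err[of x y] that by (simp add: err_prob_def p_def)
  qed
  have prod: "1 - \<delta> - \<zeta> \<le> (1 - \<delta>) * b" if "1 - \<zeta> \<le> b" for b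
  proof -
    have "1 - \<delta> - \<zeta> \<le> (1 - \<delta>) * (1 - \<zeta>)" using \<delta> \<open>0 \<le> \<zeta>\<close> by (simp add: algebra_simps)
    also have "\<dots> \<le> (1 - \<delta>) * b" using that \<delta> by (intro mult_left_mono) auto
    finally show ?thesis .
  qed
  have mt: "(1 - \<delta> - \<zeta>) * N \<le> mass t p"
  proof -
    have "(\<Sum>x\<in>cube n. 1 - \<delta> - \<zeta>) \<le> mass t p"
      unfolding mass_eq_heat
    proof (intro sum_mono)
      fix x assume x: "x \<in> cube n"
      have "1 - \<delta> - \<zeta> \<le> (1 - \<delta>) * heat t (\<lambda>y. of_bool (hamming x y = t)) x"
        using dist[OF x] by (intro prod) auto
      also have "\<dots> \<le> heat t (p x) x"
        unfolding heat_cmult[symmetric] using lower[OF x] p01 by (intro heat_mono x) auto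
      finally show "1 - \<delta> - \<zeta> \<le> heat t (p x) x" .
    qed
    thus ?thesis by (simp add: N_def mult.commute)
  qed
  have mt2: "mass (t + 2) p \<le> (\<delta> + \<zeta>) * N"
  proof -
    have "mass (t + 2) p \<le> (\<Sum>x\<in>cube n. \<delta> + \<zeta>)"
      unfolding mass_eq_heat
    proof (intro sum_mono)
      fix x assume x: "x \<in> cube n"
      have "heat (t + 2) (p x) x
          \<le> heat (t + 2) (\<lambda>y. 1 + (\<delta> - 1) * of_bool (hamming x y = t + 2)) x"
        using upper[OF x] p01 by (intro heat_mono x) auto
      also have "\<dots> \<le> 1 + (\<delta> - 1) * heat (t + 2) (\<lambda>y. of_bool (hamming x y = t + 2)) x"
        unfolding heat_add[OF x] heat_cmult using heat_le_1[of "\<lambda>_. 1" x "t + 2"] x by simp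
      also have "\<dots> \<le> \<delta> + \<zeta>"
        using prod[OF dist[OF x, of "t + 2"]] by (simp add: algebra_simps del: heat.simps)
      finally show "heat (t + 2) (p x) x \<le> \<delta> + \<zeta>" .
    qed
    thus ?thesis by (simp add: N_def mult.commute)
  qed
  have le: "mass s p \<le> N" for s unfolding N_def by (intro mass_le_card p01)
  have "2 * \<kappa> * (1 - \<eta>) * ((1 - \<delta> - \<zeta>) * N) \<le> 2 * \<kappa> * (1 - \<eta>) * mass t p"
    using \<kappa> \<eta> by (intro mult_left_mono mt) auto
  also have "\<dots> \<le> \<kappa>\<^sup>2 * mass (t + 2) p + mass (t - 2) p + T / t * mass t p + 2 ^ c * (2 * \<kappa> * \<epsilon> * N)"
    using randomized_protocol_bound[OF T t _ \<epsilon> \<eta> L cost, of \<kappa> "\<lambda>x. x @ replicate d False"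
        "\<lambda>y. y @ replicate d True"] \<kappa> unfolding p_def[abs_def] N_def by simp
  also have "\<dots> \<le> \<kappa>\<^sup>2 * ((\<delta> + \<zeta>) * N) + N + T / t * N + 2 ^ c * (2 * \<kappa> * \<epsilon> * N)"
    using T \<kappa> \<epsilon> by (intro add_mono mult_left_mono mt2 le) auto
  finally have "N * (2 * \<kappa> * (1 - \<eta>) * (1 - \<delta> - \<zeta>))
      \<le> N * (\<kappa>\<^sup>2 * (\<delta> + \<zeta>) + 1 + T / t + 2 ^ c * (2 * \<kappa> * \<epsilon>))"
    by (simp add: algebra_simps)
  thus ?thesis using N by simp
qed

section \<open>The lower bound\<close>

text \<open>Serves the case of bounded \<open>k / \<delta>\<close>: without communication the
  answers at distances \<open>k\<close> and \<open>k + 2\<close> agree, so one of them is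
  wrong.\<close>

lemma ham_protocol_not_silent:
  fixes P :: rprotocol and n k :: nat and \<delta> :: real
  assumes n: "k + 2 \<le> n" and \<delta>: "\<delta> < 1 / 2"
    and err: "\<And>x y. length x = n \<Longrightarrow> length y = n \<Longrightarrow> hamming x y \<in> {k, k + 2} \<Longrightarrow>
      err_prob P (Ham k) x y \<le> \<delta>"
  shows "\<not> cost_le P 0"
proof
  assume cost: "cost_le P 0"
  define x where "x = replicate n False"
  define y where "y j = replicate (n - j) False @ replicate j True" for j
  have ham: "hamming x (y j) = j" if "j \<le> n" for j
  proof -
    have "x = replicate (n - j) False @ replicate j False"
      using that by (simp add: x_def replicate_add[symmetric])
    hence "hamming x (y j) = hamming (replicate (n - j) False) (replicate (n - j) False) + j"
      unfolding y_def by (simp add: hamming_append)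
    thus ?thesis by (simp add: hamming_def)
  qed
  have len: "length x = n" "j \<le> n \<Longrightarrow> length (y j) = n" for j
    by (auto simp: x_def y_def)
  have "run \<tau> x (y k) = run \<tau> x (y (k + 2))" if "\<tau> \<in> set_pmf P" for \<tau>
    using cost that by (cases \<tau>) (auto simp: cost_le_def)
  hence "measure_pmf.prob P UNIV \<le> measure_pmf.prob P
      ({\<tau>. run \<tau> x (y k) \<noteq> Ham k x (y k)} \<union> {\<tau>. run \<tau> x (y (k + 2)) \<noteq> Ham k x (y (k + 2))})"
    using ham n by (intro measure_pmf.finite_measure_mono_AE AE_pmfI) (auto simp: Ham_def)
  also have "\<dots> \<le> err_prob P (Ham k) x (y k) + err_prob P (Ham k) x (y (k + 2))"
    unfolding err_prob_def by (intro measure_Un_le) auto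
  also have "\<dots> \<le> \<delta> + \<delta>"
    using n ham[of k] ham[of "k + 2"] by (intro add_mono err len) auto
  finally show False using \<delta> by simp
qed

text \<open>Here \<open>W = 1 + T / t\<close>, and the free parameter of \<open>walk_protocol_bound\<close> is set to \<open>5 / 3 * W\<close>:
  the optimum is \<open>sqrt (W / (\<delta> + \<zeta>))\<close>, and \<open>W * (\<delta> + \<zeta>)\<close> is at most about \<open>1 / 3 \<approx> (3 / 5)\<^sup>2\<close>.\<close>

lemma ham_numeric_contradiction:
  fixes \<delta> \<zeta> W :: real
  assumes \<delta>: "0 < \<delta>" "\<delta> \<le> 1/3" and \<zeta>: "\<zeta> \<le> 20 * \<delta>" "\<zeta> \<le> 1/100"
    and W: "W = 1 + 1 / (2100 * \<delta>)"
    and le: "2 * (5/3 * W) * (1 - 1/21) * (1 - \<delta> - \<zeta>)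
      \<le> (5/3 * W)\<^sup>2 * (\<delta> + \<zeta>) + W + 2 * (5/3 * W) / 100"
  shows False
proof -
  have Wpos: "W > 0" using \<delta> W by (simp add: add_pos_pos)
  have "W * (2 * (5/3) * (1 - 1/21) * (1 - \<delta> - \<zeta>)) \<le> W * ((25/9) * (W * (\<delta> + \<zeta>)) + 1 + 2 * (5/3) / 100)"
    using le by (simp add: algebra_simps power2_eq_square)
  hence "2 * (5/3) * (1 - 1/21) * (1 - \<delta> - \<zeta>) \<le> (25/9) * (W * (\<delta> + \<zeta>)) + 1 + 2 * (5/3) / 100"
    using Wpos by (simp only: mult_le_cancel_left_pos)
  moreover have "W * (\<delta> + \<zeta>) \<le> \<delta> + \<zeta> + 1/100"
  proof -
    have "W * (\<delta> + \<zeta>) = \<delta> + \<zeta> + (\<delta> + \<zeta>) / (2100 * \<delta>)" using W by (simp add: algebra_simps)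
    \<comment> \<open>Here \<open>\<zeta> \<le> 20 * \<delta>\<close> bounds the numerator by
      \<open>21 * \<delta>\<close>.\<close>
    also have "(\<delta> + \<zeta>) / (2100 * \<delta>) \<le> 1/100" using \<delta> \<zeta> by (simp add: divide_le_eq)
    finally show ?thesis by simp
  qed
  ultimately show False using \<delta> \<zeta> by (simp add: field_simps)
qed

lemma ham_lower_bound_large:
  fixes P :: rprotocol and n k c :: nat and \<delta> :: real
  assumes k: "1 \<le> k" and \<delta>: "0 < \<delta>" "\<delta> \<le> 1/3" and n: "real k ^ 2 < \<delta> * real n"
    and cost: "cost_le P c" and large: "exp 534 \<le> k / \<delta>"
    and err: "\<And>x y. length x = n \<Longrightarrow> length y = n \<Longrightarrow> hamming x y \<in> {k, k + 2} \<Longrightarrow>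
      err_prob P (Ham k) x y \<le> \<delta>"
  shows "k * log 2 (k / \<delta>) / 840 \<le> c"
proof -
  \<comment> \<open>A tenth of \<open>k\<close> keeps \<open>\<zeta>\<close> below 1/100 even at
    \<open>\<delta> = 1/3\<close>; adding 1 keeps \<open>t\<close> positive for small
    \<open>k\<close>.\<close>
  define t where "t = k div 10 + 1"
  define d where "d = k - t"
  define m where "m = n - d"
  have t: "0 < t" "t \<le> k" "k / 10 \<le> t" "t \<le> k / 10 + 1"
    using k by (auto simp: t_def field_simps)
  have kd: "k = t + d" using t by (simp add: d_def)
  have exp534: "30000 \<le> exp (534::real)"
    using exp_lower_Taylor_quadratic[of 534] by simp
  have "\<delta> * n \<le> 1/3 * real n" using \<delta> by (intro mult_right_mono) auto
  moreover have "real k \<le> real k ^ 2" using k by (simp add: self_le_power)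
  ultimately have nk: "3 * real k \<le> n" using n by linarith
  hence "d \<le> n" unfolding d_def by linarith
  hence m: "2 / 3 * n \<le> m" using nk unfolding m_def d_def by (simp add: of_nat_diff)
  have npos: "0 < real n" using nk k by linarith
  define \<zeta> where "\<zeta> = (t + 2)\<^sup>2 / (2 * m)"
  have \<zeta>_le: "\<zeta> * real k ^ 2 \<le> 3/4 * \<delta> * (real t + 2)\<^sup>2"
  proof -
    have "real ((t + 2)\<^sup>2) / real (2 * m) \<le> real ((t + 2)\<^sup>2) / (4 / 3 * n)"
      using m npos by (intro frac_le) auto
    hence "\<zeta> \<le> (real t + 2)\<^sup>2 / (4 / 3 * n)" by (simp add: \<zeta>_def add.commute)
    hence "\<zeta> * real k ^ 2 \<le> (real t + 2)\<^sup>2 / (4 / 3 * n) * (\<delta> * n)"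
      using n by (intro mult_mono) auto
    thus ?thesis using npos by (simp add: mult_ac)
  qed
  have \<zeta>1: "\<zeta> \<le> 27/4 * \<delta>"
  proof -
    have "real t \<le> real k" "1 \<le> real k" using t(2) k by simp_all
    hence "(real t + 2)\<^sup>2 \<le> (3 * real k)\<^sup>2" by (intro power_mono) auto
    hence "3/4 * \<delta> * (real t + 2)\<^sup>2 \<le> 3/4 * \<delta> * (3 * real k)\<^sup>2" using \<delta> by (intro mult_left_mono) auto
    hence "\<zeta> * real k ^ 2 \<le> (27/4 * \<delta>) * real k ^ 2" using \<zeta>_le by (simp add: power_mult_distrib)
    thus ?thesis using k by simp
  qed
  have \<zeta>2: "\<zeta> \<le> 1/100"
  proof (cases "\<delta> \<le> 1/1000")
    case True
    thus ?thesis using \<zeta>1 by simp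
  next
    case False
    have "30000 * \<delta> \<le> k" using order_trans[OF exp534 large] \<delta> by (simp add: le_divide_eq)
    hence "30 \<le> real k" using False by simp
    hence "(real t + 2)\<^sup>2 \<le> (real k / 5)\<^sup>2" using t by (intro power_mono) auto
    hence "3/4 * \<delta> * (real t + 2)\<^sup>2 \<le> 3/4 * (1/3) * (real k / 5)\<^sup>2" using \<delta> by (intro mult_mono) auto
    hence "\<zeta> * real k ^ 2 \<le> 1/100 * real k ^ 2" using \<zeta>_le by (simp add: power_divide)
    thus ?thesis using k by simp
  qed
  \<comment> \<open>This makes \<open>T / t\<close> equal to \<open>W - 1\<close>, while
    \<open>T\<close> is at least \<open>k / \<delta>\<close> divided by 21000, which is below
    \<open>2 ^ 15\<close>.\<close>
  define T where "T = t / (2100 * \<delta>)"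
  have lnT: "ln (k / \<delta>) - 15 \<le> ln T"
  proof -
    have "ln (k / \<delta>) - ln (2 ^ 15) = ln (k / \<delta> / 2 ^ 15)" 
      using k \<delta> ln_div[of "k / \<delta>" "2 ^ 15"] by simp
    also have "\<dots> \<le> ln T"
    proof (subst ln_le_cancel_iff)
      show "k / \<delta> / 2 ^ 15 \<le> T" using t \<delta> by (simp add: T_def field_simps)
    qed (use k t \<delta> in \<open>auto simp: T_def\<close>)
    finally have "ln (k / \<delta>) - ln (2 ^ 15) \<le> ln T" .
    moreover have "ln (2 ^ 15 :: real) \<le> 15" using ln_2_less_1 by (subst ln_realpow) auto
    ultimately show ?thesis by linarith
  qed
  \<comment> \<open>The constant is \<open>2 * (15 + 252)\<close>: half of
    \<open>ln (k / \<delta>)\<close> then absorbs the losses 15 from \<open>lnT\<close> and 252 from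
    the final estimate.\<close>
  have lnk: "534 \<le> ln (k / \<delta>)" using large k \<delta> by (subst ln_ge_iff) auto
  have Tpos: "T > 0" using t \<delta> by (simp add: T_def)
  have "0 < ln T" using lnT lnk by linarith
  hence T1: "1 < T" using Tpos by simp
  \<comment> \<open>Chosen so that the light leaves together cost only a hundredth of
    \<open>2 * (5/3 * W)\<close>.\<close>
  define \<epsilon> where "\<epsilon> = (1 / 2) ^ c / (100::real)"
  have \<epsilon>: "0 < \<epsilon>" by (simp add: \<epsilon>_def)
  define W where "W = 1 + 1 / (2100 * \<delta>)"
  have "\<not> (2 * ln (1 / \<epsilon>) + 2 * t) / (t * ln T) \<le> 1/21"
  proof
    assume L: "(2 * ln (1 / \<epsilon>) + 2 * t) / (t * ln T) \<le> 1/21"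
    have "0 < m" using m npos by (cases m) auto
    have "2 * (5/3 * W) * (1 - 1/21) * (1 - \<delta> - \<zeta>)
      \<le> (5/3 * W)\<^sup>2 * (\<delta> + \<zeta>) + 1 + T / t + 2 ^ c * (2 * (5/3 * W) * \<epsilon>)"
    proof (rule walk_protocol_bound[OF \<open>0 < m\<close> T1 t(1) _ \<epsilon> _ _ L cost])
      show "0 < 5/3 * W" using \<delta> by (simp add: W_def add_pos_pos)
      show "real ((t + 2)\<^sup>2) / real (2 * m) \<le> \<zeta>" by (simp add: \<zeta>_def)
      show "err_prob P (Ham (t + d)) (x @ replicate d False) (y @ replicate d True) \<le> \<delta>"
        if "x \<in> cube m" "y \<in> cube m" "hamming x y \<in> {t, t + 2}" for x y
      proof -
        have "length (x @ replicate d False) = n" "length (y @ replicate d True) = n"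
          using that \<open>d \<le> n\<close> by (auto simp: cube_def m_def)
        moreover have "hamming (x @ replicate d False) (y @ replicate d True) \<in> {k, k + 2}"
          using that by (auto simp: cube_def hamming_append kd)
        ultimately show ?thesis unfolding kd[symmetric] by (rule err)
      qed
    qed (use \<delta> in auto)
    also have "2 ^ c * (2 * (5/3 * W) * \<epsilon>) = 2 * (5/3 * W) / 100"
      by (simp add: \<epsilon>_def power_divide)
    also have "T / t = 1 / (2100 * \<delta>)" using t by (simp add: T_def)
    finally show False
      using \<zeta>1 \<zeta>2 \<delta> by (intro ham_numeric_contradiction[of \<delta> \<zeta> W]) (auto simp: W_def)
  qed
  moreover have "0 < t * ln T" using T1 t by simp
  ultimately have "t * ln T < 21 * (2 * ln (1 / \<epsilon>) + 2 * t)" by (simp add: field_simps)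
  also have "ln (1 / \<epsilon>) = c * ln 2 + ln 100"
    by (simp add: \<epsilon>_def power_divide ln_mult ln_realpow)
  also have "ln (100::real) \<le> 5 * t"
  proof -
    have "ln (100::real) \<le> ln (2 ^ 7)" by (subst ln_le_cancel_iff) auto
    also have "\<dots> \<le> 5" using ln2_le_25_over_36 by (subst ln_realpow) auto
    finally have "ln (100::real) \<le> 5" .
    thus ?thesis using t by linarith
  qed
  finally have "t * ln T < 42 * (c * ln 2) + 252 * t" by (simp add: algebra_simps)
  hence "t * (ln T - 252) \<le> 42 * (c * ln 2)" by (simp add: algebra_simps)
  moreover have "k / 10 * (ln (k / \<delta>) / 2) \<le> t * (ln T - 252)"
    using t lnT lnk by (intro mult_mono) auto
  ultimately have "k * ln (k / \<delta>) \<le> 840 * (c * ln 2)" by simp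
  thus ?thesis by (simp add: log_def divide_le_eq)
qed

theorem theorem1p8:
  "\<exists>C>0. \<forall>(n::nat) (k::nat) (\<delta>::real) (P::rprotocol) (c::nat).
      0 < \<delta> \<and> \<delta> \<le> 1/3 \<and> real k ^ 2 < \<delta> * real n \<and> cost_le P c \<and>
      (\<forall>x y. length x = n \<and> length y = n \<and>
             int (hamming x y) \<in> {int k - 2, int k, int k + 2}
             \<longrightarrow> err_prob P (Ham k) x y \<le> \<delta>)
      \<longrightarrow> real c \<ge> C * real k * log 2 (real k / \<delta>)"
proof -
  define E :: real where "E = exp 534"
  have E: "1 < E" by (simp add: E_def)
  \<comment> \<open>The second constant is for \<open>k / \<delta> < E\<close>: the claimed bound is
    then at most 1, and some bit must be sent.\<close>
  define C where "C = min (1 / 840) (1 / (E * log 2 E))"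
  have C: "0 < C" "C \<le> 1 / 840" "C \<le> 1 / (E * log 2 E)" using E by (auto simp: C_def)
  show ?thesis
  proof (intro exI[of _ C] conjI allI impI, goal_cases)
    case 1
    show ?case by (rule C)
  next
    case (2 n k \<delta> P c)
    hence \<delta>: "0 < \<delta>" "\<delta> \<le> 1/3" and n: "real k ^ 2 < \<delta> * real n" and cost: "cost_le P c"
      and err: "\<And>x y. length x = n \<Longrightarrow> length y = n \<Longrightarrow> hamming x y \<in> {k, k + 2} \<Longrightarrow>
        err_prob P (Ham k) x y \<le> \<delta>"
      by auto
    show ?case
    proof (cases "k = 0")
      case False
      hence k: "1 \<le> k" by simp
      have ratio: "1 \<le> k / \<delta>" using k \<delta> by (simp add: le_divide_eq)
      show ?thesis
      proof (cases "E \<le> k / \<delta>")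
        case True
        have "C * (k * log 2 (k / \<delta>)) \<le> 1 / 840 * (k * log 2 (k / \<delta>))"
          using C ratio by (intro mult_right_mono mult_nonneg_nonneg) auto
        also have "\<dots> \<le> c"
          using ham_lower_bound_large[OF k \<delta> n cost True[unfolded E_def] err] by linarith
        finally show ?thesis by (simp add: mult.assoc)
      next
        case small: False
        have "\<delta> * n \<le> 1/3 * real n" using \<delta> by (intro mult_right_mono) auto
        moreover have "real k \<le> real k ^ 2" using k by (simp add: self_le_power)
        ultimately have "k + 2 \<le> n" using n k by linarith
        hence "\<not> cost_le P 0" using \<delta> err by (intro ham_protocol_not_silent) auto
        hence c: "1 \<le> c" using cost by (cases c) auto
        have "k \<le> k / \<delta>" using \<delta> k by (simp add: le_divide_eq)
        hence "real k \<le> E" using small by simp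
        moreover have "log 2 (k / \<delta>) \<le> log 2 E" using small ratio by simp
        ultimately have "k * log 2 (k / \<delta>) \<le> E * log 2 E"
          using ratio E by (intro mult_mono) auto
        hence "C * (k * log 2 (k / \<delta>)) \<le> 1 / (E * log 2 E) * (E * log 2 E)"
          using C ratio E by (intro mult_mono[of C]) auto
        also have "\<dots> = 1"
        proof -
          have "0 < log 2 E" using E by simp
          hence "E * log 2 E \<noteq> 0" using E by (simp del: zero_less_log_cancel_iff)
          thus ?thesis by (metis nonzero_divide_eq_eq)
        qed
        finally show ?thesis using c by (simp add: mult.assoc)
      qed
    qed simp
  qed
qed

end
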